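(* Let $p,q,r$ be real numbers with $p \ge 0$, $q \ge 0$, $r \ge 0$, $pq-p+1>0$, $qr-q+1>0$ and $rp-r+1>0$. Then: (1) There exists an irreducible polynomial $\mathfrak{f}_{pqr} \in \mathcal{E}(\mathcal{P}_{3,3}^+)$ (its explicit expression is given in the context) which satisfies $$\mathfrak{f}_{pqr}(1,1,1)=\mathfrak{f}_{pqr}(0,p,1)=\mathfrak{f}_{pqr}(1,0,q)=\mathfrak{f}_{pqr}(r,1,0)=0.$$ (2) If $p>0$, $q>0$ and $r>0$, then every $f \in \mathcal{P}_{3,3}^+$ satisfying $f(1,1,1)=f(0,p,1)=f(1,0,q)=f(r,1,0)=0$ is of the form $f=\alpha\,\mathfrak{f}_{pqr}$ for some $\alpha\in\mathbb{R}$.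
   Context: $\mathcal{H}_{3,3}$ is the real vector space of homogeneous polynomials of degree $3$ in $x,y,z$ with real coefficients (including $0$). $\mathcal{P}_{3,3}^+$ is the set of $f\in\mathcal{H}_{3,3}$ with $f(x,y,z)\ge 0$ for all real $x,y,z\ge 0$. For a closed convex cone $\mathcal{P}$ containing no lines, a nonzero $f\in\mathcal{P}$ is extremal if $f=g+h$ with $g,h\in\mathcal{P}$ implies that $g$ and $h$ are scalar multiples of $f$; $\mathcal{E}(\mathcal{P})$ is the set of extremal elements of $\mathcal{P}$. Explicit form of $\mathfrak{f}_{pqr}$: $a_1(p,q) := pq-p+1$, $a_2(p,q,r) := p^2qr-p^2r+pqr-pq+2pr+p-r+1$, $c_1(p,q,r) := q^2 a_1(p,q)a_1(r,p)a_2(p,q,r)$, $c_2(p,q,r) := -a_1(p,q)\bigl(2p^3q^3r^3-2p^3q^2r^3+6p^2q^2r^3-2pq^3r^3+3pq^3r^2-6pq^2r^3+3pq^2r^2+2q^2r^3-pq^3-3q^2r^2+3pq^2-3pq+q^2+p-1\bigr)$, $c_3(p,q,r) := r\,a_1(p,q)\bigl(p^3q^3r^3-p^3q^2r^3+3p^2q^2r^3-pq^3r^3-3pq^2r^3+3pq^3r+q^2r^3-2pq^3-3pq^2r+6pq^2-3q^2r-6pq+2q^2+2p-2\bigr)$, $c_4(p,q,r) := -c_1(p,q,r)-c_1(q,r,p)-c_1(r,p,q)-c_2(p,q,r)-c_2(q,r,p)-c_2(r,p,q)-c_3(p,q,r)-c_3(q,r,p)-c_3(r,p,q)$, $\mathfrak{f}_{pqr}(x,y,z)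 := c_1(p,q,r)x^3+c_1(q,r,p)y^3+c_1(r,p,q)z^3+c_2(p,q,r)x^2y+c_3(p,q,r)xy^2+c_2(q,r,p)y^2z+c_3(q,r,p)yz^2+c_2(r,p,q)z^2x+c_3(r,p,q)zx^2+c_4(p,q,r)xyz$. *)

theory Defs
  imports Complex_Main "HOL-Computational_Algebra.Computational_Algebra"
begin

text \<open>
  The ring \<open>\<real>[x,y,z]\<close> is represented as \<open>\<real>[x][y][z]\<close>, with \<open>z\<close> the outermost variable; it
  carries the library's notion of \<^const>\<open>irreducible\<close> (here: irreducible over the reals).
\<close>

type_synonym poly3 = "real poly poly poly"

definition const3 :: "real \<Rightarrow> poly3" where
  "const3 c = [:[:[:c:]:]:]"

definition X3 :: poly3 where "X3 = [:[:[:0, 1:]:]:]"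
definition Y3 :: poly3 where "Y3 = [:[:0, 1:]:]"
definition Z3 :: poly3 where "Z3 = [:0, 1:]"

definition coeff3 :: "poly3 \<Rightarrow> nat \<Rightarrow> nat \<Rightarrow> nat \<Rightarrow> real" where
  "coeff3 f i j k = coeff (coeff (coeff f k) j) i"

definition eval3 :: "poly3 \<Rightarrow> real \<Rightarrow> real \<Rightarrow> real \<Rightarrow> real" where
  "eval3 f x y z = poly (poly (poly f [:[:z:]:]) [:y:]) x"

lemma eval3_simps [simp]:
  "eval3 (const3 c) x y z = c"
  "eval3 X3 x y z = x"
  "eval3 Y3 x y z = y"
  "eval3 Z3 x y z = z"
  "eval3 (f + g) x y z = eval3 f x y z + eval3 g x y z"
  "eval3 (f * g) x y z = eval3 f x y z * eval3 g x y z"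
  "eval3 (f ^ n) x y z = eval3 f x y z ^ n"
  by (simp_all add: eval3_def const3_def X3_def Y3_def Z3_def)

definition H33 :: "poly3 set" where
  "H33 = {f. \<forall>i j k. coeff3 f i j k \<noteq> 0 \<longrightarrow> i + j + k = 3}"

definition P33_plus :: "poly3 set" where
  "P33_plus = {f \<in> H33. \<forall>x y z. x \<ge> 0 \<longrightarrow> y \<ge> 0 \<longrightarrow> z \<ge> 0 \<longrightarrow> eval3 f x y z \<ge> 0}"

text \<open>Multiplication by \<open>const3 a\<close> is multiplication by the real scalar \<open>a\<close>.\<close>

definition extremals :: "poly3 set \<Rightarrow> poly3 set" where
  "extremals P = {f \<in> P. f \<noteq> 0 \<and>
     (\<forall>g\<in>P. \<forall>h\<in>P. f = g + h \<longrightarrow> (\<exists>a. g = const3 a * f) \<and> (\<exists>b. h = const3 b * f))}"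

definition a1 :: "real \<Rightarrow> real \<Rightarrow> real" where
  "a1 p q = p * q - p + 1"

definition a2 :: "real \<Rightarrow> real \<Rightarrow> real \<Rightarrow> real" where
  "a2 p q r = p^2*q*r - p^2*r + p*q*r - p*q + 2*p*r + p - r + 1"

definition c1 :: "real \<Rightarrow> real \<Rightarrow> real \<Rightarrow> real" where
  "c1 p q r = q^2 * a1 p q * a1 r p * a2 p q r"

definition c2 :: "real \<Rightarrow> real \<Rightarrow> real \<Rightarrow> real" where
  "c2 p q r = - a1 p q *
     (2*p^3*q^3*r^3 - 2*p^3*q^2*r^3 + 6*p^2*q^2*r^3 - 2*p*q^3*r^3 + 3*p*q^3*r^2
      - 6*p*q^2*r^3 + 3*p*q^2*r^2 + 2*q^2*r^3 - p*q^3 - 3*q^2*r^2 + 3*p*q^2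
      - 3*p*q + q^2 + p - 1)"

definition c3 :: "real \<Rightarrow> real \<Rightarrow> real \<Rightarrow> real" where
  "c3 p q r = r * a1 p q *
     (p^3*q^3*r^3 - p^3*q^2*r^3 + 3*p^2*q^2*r^3 - p*q^3*r^3 - 3*p*q^2*r^3
      + 3*p*q^3*r + q^2*r^3 - 2*p*q^3 - 3*p*q^2*r + 6*p*q^2 - 3*q^2*r
      - 6*p*q + 2*q^2 + 2*p - 2)"

definition c4 :: "real \<Rightarrow> real \<Rightarrow> real \<Rightarrow> real" where
  "c4 p q r = - c1 p q r - c1 q r p - c1 r p q
              - c2 p q r - c2 q r p - c2 r p q
              - c3 p q r - c3 q r p - c3 r p q"

definition f_pqr :: "real \<Rightarrow> real \<Rightarrow> real \<Rightarrow> poly3" where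
  "f_pqr p q r =
     const3 (c1 p q r) * X3^3 + const3 (c1 q r p) * Y3^3 + const3 (c1 r p q) * Z3^3
   + const3 (c2 p q r) * X3^2 * Y3 + const3 (c3 p q r) * X3 * Y3^2
   + const3 (c2 q r p) * Y3^2 * Z3 + const3 (c3 q r p) * Y3 * Z3^2
   + const3 (c2 r p q) * Z3^2 * X3 + const3 (c3 r p q) * Z3 * X3^2
   + const3 (c4 p q r) * X3 * Y3 * Z3"

end

theory Submission
  imports Defs
begin

text \<open>
A cubic form that is nonnegative on the octant and vanishes at \<open>e = (1,1,1)\<close> has a singular point
there. If it also vanishes at \<open>(0,p,1)\<close>, \<open>(1,0,q)\<close>, \<open>(r,1,0)\<close> with \<open>p, q, r > 0\<close>, then its
restriction to each coordinate plane has a double root. The three double roots leave the four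
unknowns \<open>u, v, w, m\<close> of \<open>tangent_cubic\<close>, and the singularity imposes three independent linear
equations on them (\<open>proportional_if_singular\<close>). So such a form is unique up to a scalar; solving
the equations gives \<open>u, v, w\<close> as the three cyclic instances of \<open>edge_weight\<close>, all positive, and
the form is \<open>f_pqr\<close>.

Nonnegativity of this form \<open>f\<close> is seen along lines through the singular point. For a real \<open>s\<close> and
a vector \<open>b\<close>, \<open>f (s e + b) = s/2 * Q b + f b\<close>, where \<open>Q\<close> is the Hessian form at \<open>e\<close>. The values of
\<open>Q\<close> at pairs of the three boundary zeros show that \<open>Q\<close> is a combination, with positive
coefficients, of the squares of the linear forms that cut out the planes through \<open>e\<close> and one
boundary zero (\<open>hessian_at_ones\<close>). Every point of the octant is \<open>s e + b\<close> with \<open>s \<ge> 0\<close> and \<open>b\<close> on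
a face, and on a face \<open>f\<close> is a square times a linear form with nonnegative coefficients.

For extremality, let \<open>f = g + h\<close> in the cone. Both summands vanish at the four zeros of \<open>f\<close>. The
derivatives along the faces at the boundary zeros are nonnegative for \<open>g\<close> and \<open>h\<close>, even when the
zero is a vertex of the octant (\<open>p = 0\<close>, say), and they sum to the derivative of \<open>f\<close>, which is
\<open>0\<close>. So \<open>g\<close> and \<open>h\<close> again have the three double roots, and rigidity applies to them.

For irreducibility, factors of a homogeneous polynomial are homogeneous, so a proper factorization
is \<open>f = L * H\<close> with \<open>L\<close> linear and \<open>H\<close> quadratic. If \<open>L e = 0\<close>, then \<open>f\<close> vanishes on a plane through
\<open>e\<close>, which forces \<open>Q\<close> to vanish there, although \<open>Q\<close> is zero only on the line through \<open>e\<close>. If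
\<open>L e \<noteq> 0\<close>, then \<open>H\<close> is a multiple of \<open>Q\<close>, hence nonzero at \<open>(0,p,1)\<close>, so that \<open>L\<close> alone accounts for
the double root there; being linear, \<open>L\<close> vanishes on the plane \<open>x = 0\<close>, but \<open>f\<close> does not.
\<close>

section \<open>Homogeneous polynomials in three variables\<close>

definition homogeneous3 :: "nat \<Rightarrow> poly3 \<Rightarrow> bool" where
  "homogeneous3 n f \<longleftrightarrow> (\<forall>i j k. coeff3 f i j k \<noteq> 0 \<longrightarrow> i + j + k = n)"

lemma coeff3_eqI:
  assumes "\<And>i j k. coeff3 f i j k = coeff3 g i j k"
  shows "f = g"
  using assms by (auto simp: coeff3_def intro!: poly_eqI)

lemma coeff3_add: "coeff3 (f + g) i j k = coeff3 f i j k + coeff3 g i j k"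
  by (simp add: coeff3_def)

lemma coeff3_monomial:
  "coeff3 (const3 c * X3 ^ a * Y3 ^ b * Z3 ^ d) i j k = (if i = a \<and> j = b \<and> k = d then c else 0)"
proof -
  have X: "X3 ^ a = [:[:monom 1 a:]:]"
    by (induction a) (simp_all add: X3_def monom_0 pCons_one monom_Suc)
  have Y: "Y3 ^ b = [:monom 1 b:]"
    by (induction b) (simp_all add: Y3_def monom_0 pCons_one monom_Suc)
  have Z: "Z3 ^ d = monom 1 d"
    by (induction d) (simp_all add: Z3_def monom_0 pCons_one monom_Suc)
  have "const3 c * X3 ^ a * Y3 ^ b * Z3 ^ d = monom (monom (monom c a) b) d"
    by (simp add: X Y Z const3_def smult_monom)
  then show ?thesis
    by (auto simp: coeff3_def)
qed

lemma poly_eqI_infinite: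
  fixes p q :: "'a::idom poly"
  assumes "infinite A" "\<And>a. a \<in> A \<Longrightarrow> poly p a = poly q a"
  shows "p = q"
proof (rule ccontr)
  assume "p \<noteq> q"
  then have "finite {a. poly (p - q) a = 0}" by (intro poly_roots_finite) simp
  moreover have "A \<subseteq> {a. poly (p - q) a = 0}" using assms(2) by auto
  ultimately show False using assms(1) finite_subset by blast
qed

lemma eval3_inject:
  assumes "\<And>x y z. eval3 f x y z = eval3 g x y z"
  shows "f = g"
proof (rule poly_eqI_infinite[where A = "range (\<lambda>z. [:[:z:]:])"])
  show "infinite (range (\<lambda>z::real. [:[:z:]:]))"
    by (auto simp: finite_image_iff inj_on_def infinite_UNIV_char_0)
  fix a :: "real poly poly" assume "a \<in> range (\<lambda>z. [:[:z:]:])"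
  then obtain z where a: "a = [:[:z:]:]" by auto
  show "poly f a = poly g a"
  proof (rule poly_eqI_infinite[where A = "range (\<lambda>y. [:y:])"])
    show "infinite (range (\<lambda>y::real. [:y:]))"
      by (auto simp: finite_image_iff inj_on_def infinite_UNIV_char_0)
    fix b :: "real poly" assume "b \<in> range (\<lambda>y. [:y:])"
    then obtain y where b: "b = [:y:]" by auto
    show "poly (poly f a) b = poly (poly g a) b"
      using assms by (intro poly_eqI_infinite[where A = UNIV] infinite_UNIV_char_0)
        (simp add: a b eval3_def)
  qed
qed

lemma poly_eq_sum_atMost:
  fixes p :: "'a::comm_ring_1 poly"
  assumes "\<And>i. n < i \<Longrightarrow> coeff p i = 0"
  shows "poly p x = (\<Sum>i\<le>n. coeff p i * x ^ i)"
proof -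
  have "degree p \<le> n" by (rule degree_le) (use assms in blast)
  then have "(\<Sum>i\<le>n. coeff p i * x ^ i) = (\<Sum>i\<le>degree p. coeff p i * x ^ i)"
    by (intro sum.mono_neutral_right) (auto simp: coeff_eq_0)
  then show ?thesis by (simp only: poly_altdef)
qed

lemma eval3_homogeneous:
  assumes "homogeneous3 n f"
  shows "eval3 f x y z = (\<Sum>k\<le>n. \<Sum>j\<le>n. \<Sum>i\<le>n. coeff3 f i j k * x ^ i * y ^ j * z ^ k)"
proof -
  have 0: "coeff (coeff (coeff f k) j) i = 0" if "i + j + k \<noteq> n" for i j k
    using assms that unfolding homogeneous3_def coeff3_def by blast
  have "poly f [:[:z:]:] = (\<Sum>k\<le>n. coeff f k * [:[:z:]:] ^ k)"
    by (rule poly_eq_sum_atMost) (intro poly_eqI, simp add: 0)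
  moreover have "poly (coeff f k) [:y:] = (\<Sum>j\<le>n. coeff (coeff f k) j * [:y:] ^ j)" for k
    by (rule poly_eq_sum_atMost) (intro poly_eqI, simp add: 0)
  moreover have "poly (coeff (coeff f k) j) x = (\<Sum>i\<le>n. coeff (coeff (coeff f k) j) i * x ^ i)"
    for j k by (rule poly_eq_sum_atMost) (simp add: 0)
  ultimately show ?thesis
    by (simp add: eval3_def poly_sum poly_power coeff3_def sum_distrib_right)
qed

lemma homogeneous3_coeff: "homogeneous3 n f \<Longrightarrow> i + j + k \<noteq> n \<Longrightarrow> coeff3 f i j k = 0"
  by (auto simp: homogeneous3_def)

lemma eval3_linear_form:
  assumes "homogeneous3 1 f"
  shows "eval3 f x y z = coeff3 f 1 0 0 * x + coeff3 f 0 1 0 * y + coeff3 f 0 0 1 * z"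
  using assms by (simp add: eval3_homogeneous[OF assms] homogeneous3_coeff)

lemma eval3_quadratic_form:
  assumes "homogeneous3 2 f"
  shows "eval3 f x y z = coeff3 f 2 0 0 * x^2 + coeff3 f 0 2 0 * y^2 + coeff3 f 0 0 2 * z^2
     + coeff3 f 1 1 0 * x * y + coeff3 f 0 1 1 * y * z + coeff3 f 1 0 1 * z * x"
  using assms by (simp add: eval3_homogeneous[OF assms] homogeneous3_coeff numeral_eq_Suc)

section \<open>Factors of homogeneous polynomials\<close>

text \<open>
Maps that preserve \<open>0\<close>, sums and products, and their extension to polynomials that sends the
variable to \<open>t\<close>. Iterating the extension three times gives the substitution
\<open>x \<mapsto> x t, y \<mapsto> y t, z \<mapsto> z t\<close> below, whose multiplicativity is then automatic.
\<close>

definition mult_hom :: "('a::comm_ring_1 \<Rightarrow> 'b::comm_ring_1) \<Rightarrow> bool" where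
  "mult_hom \<phi> \<longleftrightarrow> \<phi> 0 = 0 \<and> (\<forall>a b. \<phi> (a + b) = \<phi> a + \<phi> b) \<and> (\<forall>a b. \<phi> (a * b) = \<phi> a * \<phi> b)"

definition subst_hom :: "('a::comm_ring_1 \<Rightarrow> 'b::comm_ring_1) \<Rightarrow> 'b \<Rightarrow> 'a poly \<Rightarrow> 'b" where
  "subst_hom \<phi> t p = poly (map_poly \<phi> p) t"

lemma subst_hom_0: "subst_hom \<phi> t 0 = 0"
  by (simp add: subst_hom_def)

lemma subst_hom_pCons:
  "mult_hom \<phi> \<Longrightarrow> subst_hom \<phi> t (pCons c p) = \<phi> c + t * subst_hom \<phi> t p"
  by (simp add: mult_hom_def subst_hom_def map_poly_pCons)

lemma mult_hom_subst_hom: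
  assumes "mult_hom \<phi>"
  shows "mult_hom (subst_hom \<phi> t)"
proof -
  have \<phi>: "\<phi> 0 = 0" "\<phi> (a + b) = \<phi> a + \<phi> b" "\<phi> (a * b) = \<phi> a * \<phi> b" for a b
    using assms by (auto simp: mult_hom_def)
  note [simp] = subst_hom_0 subst_hom_pCons[OF assms] \<phi>
  have add: "subst_hom \<phi> t (p + q) = subst_hom \<phi> t p + subst_hom \<phi> t q" for p q
  proof (induction p arbitrary: q)
    case (pCons a p)
    then show ?case by (cases q) (simp add: algebra_simps)
  qed simp
  have smult: "subst_hom \<phi> t (smult a p) = \<phi> a * subst_hom \<phi> t p" for a p
    by (induction p) (auto simp: algebra_simps)
  have "subst_hom \<phi> t (p * q) = subst_hom \<phi> t p * subst_hom \<phi> t q" for p q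
    by (induction p) (auto simp: algebra_simps add smult)
  with add show ?thesis by (simp add: mult_hom_def)
qed

text \<open>
The ring homomorphism \<open>g(x,y,z) \<mapsto> g(x t, y t, z t)\<close>, with \<open>t\<close> a new outermost variable. The
coefficient of \<open>t^n\<close> is the homogeneous component of degree \<open>n\<close>; see \<open>coeff_grade\<close>.
\<close>

definition grade1 :: "real poly \<Rightarrow> poly3 poly" where
  "grade1 = subst_hom (\<lambda>c. [:const3 c:]) [:0, X3:]"
definition grade2 :: "real poly poly \<Rightarrow> poly3 poly" where
  "grade2 = subst_hom grade1 [:0, Y3:]"
definition grade :: "poly3 \<Rightarrow> poly3 poly" where
  "grade = subst_hom grade2 [:0, Z3:]"

lemma mult_hom_const3: "mult_hom (\<lambda>c. [:const3 c:])"
  by (auto simp: mult_hom_def const3_def)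

lemma mult_hom_grade1: "mult_hom grade1"
  unfolding grade1_def by (intro mult_hom_subst_hom mult_hom_const3)
lemma mult_hom_grade2: "mult_hom grade2"
  unfolding grade2_def by (intro mult_hom_subst_hom mult_hom_grade1)
lemma mult_hom_grade: "mult_hom grade"
  unfolding grade_def by (intro mult_hom_subst_hom mult_hom_grade2)

lemma coeff3_XYZ_mult:
  "coeff3 (X3 * f) i j k = (case i of 0 \<Rightarrow> 0 | Suc i' \<Rightarrow> coeff3 f i' j k)"
  "coeff3 (Y3 * f) i j k = (case j of 0 \<Rightarrow> 0 | Suc j' \<Rightarrow> coeff3 f i j' k)"
  "coeff3 (Z3 * f) i j k = (case k of 0 \<Rightarrow> 0 | Suc k' \<Rightarrow> coeff3 f i j k')"
  by (auto simp: coeff3_def X3_def Y3_def Z3_def coeff_pCons split: nat.splits)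

lemma coeff3_pCons:
  "coeff3 (pCons c f) i j k = (case k of 0 \<Rightarrow> coeff (coeff c j) i | Suc k' \<Rightarrow> coeff3 f i j k')"
  by (auto simp: coeff3_def split: nat.splits)

lemma coeff3_0 [simp]: "coeff3 0 i j k = 0"
  by (simp add: coeff3_def)

lemma coeff3_const3: "coeff3 (const3 c) i j k = (if i = 0 \<and> j = 0 \<and> k = 0 then c else 0)"
  using coeff3_monomial[of c 0 0 0 i j k] by simp

lemma coeff_grade1:
  "coeff3 (coeff (grade1 p) n) i j k = (if i = n \<and> j = 0 \<and> k = 0 then coeff p i else 0)"
proof (induction p arbitrary: n i)
  case 0
  then show ?case by (simp add: grade1_def subst_hom_0)
next
  case (pCons c p)
  have "grade1 (pCons c p) = [:const3 c:] + [:0, X3:] * grade1 p"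
    unfolding grade1_def by (rule subst_hom_pCons[OF mult_hom_const3])
  then show ?case
    using pCons.IH
    by (auto simp: coeff_pCons coeff3_add coeff3_XYZ_mult coeff3_const3 split: nat.splits)
qed

lemma coeff_grade2:
  "coeff3 (coeff (grade2 p) n) i j k = (if i + j = n \<and> k = 0 then coeff (coeff p j) i else 0)"
proof (induction p arbitrary: n j)
  case 0
  then show ?case by (simp add: grade2_def subst_hom_0)
next
  case (pCons c p)
  have "grade2 (pCons c p) = grade1 c + [:0, Y3:] * grade2 p"
    unfolding grade2_def by (rule subst_hom_pCons[OF mult_hom_grade1])
  then show ?case
    using pCons.IH
    by (auto simp: coeff_pCons coeff3_add coeff3_XYZ_mult coeff_grade1 split: nat.splits)
qed

lemma coeff_grade:
  "coeff3 (coeff (grade f) n) i j k = (if i + j + k = n then coeff3 f i j k else 0)"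
proof (induction f arbitrary: n k)
  case 0
  then show ?case by (simp add: grade_def subst_hom_0)
next
  case (pCons c p)
  have "grade (pCons c p) = grade2 c + [:0, Z3:] * grade p"
    unfolding grade_def by (rule subst_hom_pCons[OF mult_hom_grade2])
  then have "coeff3 (coeff (grade (pCons c p)) n) i j k =
      (case k of 0 \<Rightarrow> coeff3 (coeff (grade2 c) n) i j k
       | Suc k' \<Rightarrow> (case n of 0 \<Rightarrow> 0 | Suc n' \<Rightarrow> coeff3 (coeff (grade p) n') i j k'))"
    by (auto simp: coeff_pCons coeff3_add coeff3_XYZ_mult coeff_grade2 split: nat.splits)
  also have "\<dots> = (if i + j + k = n then coeff3 (pCons c p) i j k else 0)"
    using pCons.IH
    by (auto simp: coeff_grade2 coeff3_pCons split: nat.splits)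
  finally show ?case .
qed

lemma grade_homogeneous:
  assumes "homogeneous3 n f"
  shows "grade f = monom f n"
proof (rule poly_eqI, rule coeff3_eqI)
  fix m i j k
  show "coeff3 (coeff (grade f) m) i j k = coeff3 (coeff (monom f n) m) i j k"
    using assms by (auto simp: coeff_grade homogeneous3_def)
qed

text \<open>
Degree and order at \<open>0\<close> are both additive on products. They agree on a monomial, and the order never
exceeds the degree, so they agree on each factor.
\<close>

lemma monom_factor:
  fixes P Q :: "'a::idom poly"
  assumes "P * Q = monom c n" "c \<noteq> 0"
  obtains a b d e where "P = monom d a" "Q = monom e b" "a + b = n"
proof -
  have nz: "P * Q \<noteq> 0" using assms by simp
  then have PQ: "P \<noteq> 0" "Q \<noteq> 0" by auto
  have "order 0 P + order 0 Q = n"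
    using order_mult[OF nz, of 0] assms by (simp add: order_0_monom)
  moreover have "degree P + degree Q = n"
    using degree_mult_eq[OF PQ] assms by (simp add: degree_monom_eq)
  moreover have "order 0 P \<le> degree P" "order 0 Q \<le> degree Q"
    using PQ by (auto intro: order_degree)
  ultimately have o: "order 0 P = degree P" "order 0 Q = degree Q" by auto
  have mono: "R = monom (lead_coeff R) (degree R)" if "order 0 R = degree R" "R \<noteq> 0" for R :: "'a poly"
  proof -
    have "monom 1 (degree R) dvd R"
      using order_1[of 0 R] that by (simp add: monom_altdef)
    then have "coeff R k = 0" if "k < degree R" for k
      using that by (simp add: monom_1_dvd_iff')
    then show ?thesis
      by (intro poly_eqI) (metis coeff_eq_0 coeff_monom linorder_neqE_nat)
  qed
  show thesis
    using that[OF mono[OF o(1) PQ(1)] mono[OF o(2) PQ(2)]] \<open>degree P + degree Q = n\<close> by simp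
qed

text \<open>
The image of the product under \<^const>\<open>grade\<close> is a monomial in \<open>t\<close>, hence so are the images of the
factors.
\<close>

lemma homogeneous3_factor:
  assumes "homogeneous3 n (g * h)" "g * h \<noteq> 0"
  obtains a b where "homogeneous3 a g" "homogeneous3 b h" "a + b = n"
proof -
  have "grade g * grade h = monom (g * h) n"
    using grade_homogeneous[OF assms(1)] mult_hom_grade by (simp add: mult_hom_def)
  then obtain a b d e where *: "grade g = monom d a" "grade h = monom e b" "a + b = n"
    using assms(2) by (rule monom_factor)
  have hom: "homogeneous3 a f" if "grade f = monom d a" for f a d
    unfolding homogeneous3_def
  proof (intro allI impI)
    fix i j k assume nz: "coeff3 f i j k \<noteq> 0"
    have "coeff3 (coeff (monom d a) (i + j + k)) i j k = coeff3 f i j k"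
      unfolding that[symmetric] coeff_grade by simp
    with nz show "i + j + k = a"
      by (auto split: if_splits)
  qed
  show thesis by (rule that[OF hom[OF *(1)] hom[OF *(2)] *(3)])
qed

lemma is_unit_if_homogeneous3_0:
  assumes "homogeneous3 0 f" "f \<noteq> 0"
  shows "f dvd 1"
proof -
  define c where "c = coeff3 f 0 0 0"
  have f: "f = const3 c"
    using assms(1) by (intro coeff3_eqI) (auto simp: coeff3_const3 c_def homogeneous3_def)
  with assms(2) have "c \<noteq> 0" by (auto simp: const3_def)
  then have "f * const3 (1 / c) = 1"
    by (simp add: f const3_def one_pCons)
  then show ?thesis by (intro dvdI) (rule sym)
qed

section \<open>Cubics touching the three faces\<close>

definition cubic :: "real \<Rightarrow> real \<Rightarrow> real \<Rightarrow> real \<Rightarrow> real \<Rightarrow> real \<Rightarrow> real \<Rightarrow> real \<Rightarrow> real \<Rightarrow> real \<Rightarrow>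
    real \<Rightarrow> real \<Rightarrow> real \<Rightarrow> real" where
  "cubic X Y Z a b c d e k m x y z =
     X * x^3 + Y * y^3 + Z * z^3 + a * x^2 * y + b * x * y^2 + c * y^2 * z + d * y * z^2
     + e * z^2 * x + k * z * x^2 + m * x * y * z"

text \<open>
The cubic forms whose restrictions to the faces have the double roots \<open>y = p z\<close>, \<open>z = q x\<close> and
\<open>x = r y\<close>. The restriction to \<open>x = 0\<close> is \<open>(y - p z)^2 (r^2 v y + w z)\<close>, and its coefficient \<open>p^2 w\<close> of
\<open>z^3\<close> is shared with the face \<open>y = 0\<close>; going round the three faces, everything but the coefficient
\<open>m\<close> of \<open>x y z\<close> is determined by \<open>u, v, w\<close>. This parametrization stays valid when some of
\<open>p, q, r\<close> are \<open>0\<close>, where the coefficients of \<open>x^3, y^3, z^3\<close> would not suffice.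
\<close>

definition tangent_cubic ::
    "real \<Rightarrow> real \<Rightarrow> real \<Rightarrow> real \<Rightarrow> real \<Rightarrow> real \<Rightarrow> real \<Rightarrow> real \<Rightarrow> real \<Rightarrow> real \<Rightarrow> real" where
  "tangent_cubic p q r u v w =
     cubic (q^2 * u) (r^2 * v) (p^2 * w) (v - 2 * r * (q^2 * u)) (r^2 * (q^2 * u) - 2 * r * v)
       (w - 2 * p * (r^2 * v)) (p^2 * (r^2 * v) - 2 * p * w)
       (u - 2 * q * (p^2 * w)) (q^2 * (p^2 * w) - 2 * q * u)"

lemma tangent_cubic_cyclic:
  "tangent_cubic p q r u v w m x y z = tangent_cubic q r p v w u m y z x"
  by (simp add: tangent_cubic_def cubic_def)

lemma tangent_cubic_edge:
  "tangent_cubic p q r u v w m 0 y z = (y - p * z)^2 * (r^2 * v * y + w * z)"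
  by (simp add: tangent_cubic_def cubic_def algebra_simps power2_eq_square power3_eq_cube)

section \<open>The singular point\<close>

text \<open>
The \<open>x\<close>-derivative of a tangent cubic at \<open>(1,1,1)\<close>; the other two partial derivatives are the cyclic
shifts. By Euler's formula the value at \<open>(1,1,1)\<close> vanishes if all three do.
\<close>

definition dx_at_ones :: "real \<Rightarrow> real \<Rightarrow> real \<Rightarrow> real \<Rightarrow> real \<Rightarrow> real \<Rightarrow> real \<Rightarrow> real" where
  "dx_at_ones p q r u v w m =
     3 * (q^2 * u) + 2 * (v - 2 * r * (q^2 * u)) + (r^2 * (q^2 * u) - 2 * r * v)
     + (u - 2 * q * (p^2 * w)) + 2 * (q^2 * (p^2 * w) - 2 * q * u) + m"

text \<open>
The solution \<open>u\<close> of the three derivative equations, up to a common factor; \<open>v\<close> and \<open>w\<close> are its cyclic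
shifts.
\<close>

definition edge_weight :: "real \<Rightarrow> real \<Rightarrow> real \<Rightarrow> real" where
  "edge_weight p q r = a1 p q * a1 r p * a2 p q r"

text \<open>
Eliminating \<open>m\<close> leaves two linear equations \<open>R\<^sub>1 \<bullet> b = R\<^sub>2 \<bullet> b = 0\<close> for \<open>b = (u,v,w)\<close>, and the
cross product \<open>R\<^sub>1 \<times> R\<^sub>2\<close> is three times the vector of edge weights. Hence
\<open>b \<times> (R\<^sub>1 \<times> R\<^sub>2) = R\<^sub>1 (R\<^sub>2 \<bullet> b) - R\<^sub>2 (R\<^sub>1 \<bullet> b)\<close> vanishes, and \<open>b\<close> is parallel to the weights.
\<close>

lemma proportional_if_singular:
  assumes "dx_at_ones p q r u v w m = 0" "dx_at_ones q r p v w u m = 0"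
    "dx_at_ones r p q w u v m = 0"
  shows "u * edge_weight q r p = v * edge_weight p q r"
proof -
  (* The third component of the vector identity above. The factors in parentheses are the
     coefficients of w in R\<^sub>1 = (x-derivative) - (y-derivative) and in
     R\<^sub>2 = (y-derivative) - (z-derivative). *)
  have "3 * (u * edge_weight q r p - v * edge_weight p q r) =
      ((2*q^2*p^2 - 2*q*p^2) - (2 - 2 * p)) * (dx_at_ones q r p v w u m - dx_at_ones r p q w u v m)
    - ((2 - 2 * p) - (3*p^2-4*q*p^2+q^2*p^2+1-4*p)) * (dx_at_ones p q r u v w m - dx_at_ones q r p v w u m)"
    unfolding dx_at_ones_def edge_weight_def a1_def a2_def by algebra
  with assms show ?thesis by simp
qed

text \<open>
This way of writing \<^const>\<open>a2\<close> makes its positivity, and with it that of the weights, evident.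
\<close>

lemma a2_eq: "a2 p q r = p * r * a1 p q + p * a1 q r + a1 r p"
  by (simp add: a1_def a2_def algebra_simps power2_eq_square)

lemma a2_pos:
  assumes "p \<ge> 0" "r \<ge> 0" "a1 p q > 0" "a1 q r > 0" "a1 r p > 0"
  shows "a2 p q r > 0"
  unfolding a2_eq using assms by (intro add_nonneg_pos add_nonneg_nonneg) simp_all

lemma edge_weight_pos:
  assumes "p \<ge> 0" "r \<ge> 0" "a1 p q > 0" "a1 q r > 0" "a1 r p > 0"
  shows "edge_weight p q r > 0"
  using assms by (simp add: edge_weight_def a2_pos)

text \<open>
The polynomial function of \<^const>\<open>f_pqr\<close>, displayed as a tangent cubic (\<open>eval3_f_pqr\<close>).
\<close>

definition extremal_cubic :: "real \<Rightarrow> real \<Rightarrow> real \<Rightarrow> real \<Rightarrow> real \<Rightarrow> real \<Rightarrow> real" where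
  "extremal_cubic p q r =
     tangent_cubic p q r (edge_weight p q r) (edge_weight q r p) (edge_weight r p q) (c4 p q r)"

lemma c_edge_weight:
  "c1 p q r = q^2 * edge_weight p q r"
  "c2 p q r = edge_weight q r p - 2 * r * (q^2 * edge_weight p q r)"
  "c3 p q r = r^2 * (q^2 * edge_weight p q r) - 2 * r * edge_weight q r p"
  unfolding edge_weight_def c1_def c2_def c3_def a1_def a2_def by algebra+

lemma eval3_f_pqr: "eval3 (f_pqr p q r) x y z = extremal_cubic p q r x y z"
  by (simp add: f_pqr_def extremal_cubic_def tangent_cubic_def cubic_def c_edge_weight)

lemma c4_cyclic: "c4 p q r = c4 q r p"
  by (simp add: c4_def)

lemma extremal_cubic_cyclic: "extremal_cubic p q r x y z = extremal_cubic q r p y z x"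
  unfolding extremal_cubic_def c4_cyclic[of p q r] by (rule tangent_cubic_cyclic)

lemma dx_extremal_cubic:
  "dx_at_ones p q r (edge_weight p q r) (edge_weight q r p) (edge_weight r p q) (c4 p q r) = 0"
  unfolding c4_def c_edge_weight unfolding dx_at_ones_def edge_weight_def a1_def a2_def by algebra

section \<open>Nonnegativity\<close>

text \<open>
Taylor expansion at the singular point \<open>e = (1,1,1)\<close> in the direction \<open>(x,y,z)\<close>. As \<open>e\<close> lies in the
kernel of the Hessian, the quadratic term is determined by the three diagonal second derivatives.
\<close>

lemma cubic_expand_along_ones:
  assumes "3 * X + 2 * a + b + e + 2 * k + m = 0"
    and "3 * Y + 2 * c + d + a + 2 * b + m = 0"
    and "3 * Z + 2 * e + k + c + 2 * d + m = 0"
  shows "cubic X Y Z a b c d e k m (s + x) (s + y) (s + z) =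
    s * ((3 * X + a + k) * (x - y) * (x - z) + (3 * Y + b + c) * (y - x) * (y - z)
         + (3 * Z + d + e) * (z - x) * (z - y)) + cubic X Y Z a b c d e k m x y z"
proof -
  \<comment> \<open>the partial derivatives at \<open>(1,1,1)\<close>, kept symbolic so that the expansion is an identity\<close>
  define gx where "gx = 3 * X + 2 * a + b + e + 2 * k + m"
  define gy where "gy = 3 * Y + 2 * c + d + a + 2 * b + m"
  define gz where "gz = 3 * Z + 2 * e + k + c + 2 * d + m"
  have "3 * cubic X Y Z a b c d e k m (s + x) (s + y) (s + z) =
    3 * (s * ((3 * X + a + k) * (x - y) * (x - z) + (3 * Y + b + c) * (y - x) * (y - z)
         + (3 * Z + d + e) * (z - x) * (z - y)) + cubic X Y Z a b c d e k m x y z)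
    + 3 * s^2 * (gx * x + gy * y + gz * z) + s^3 * (gx + gy + gz)
    + 3 * s * ((gx + gy - gz) * x * y + (gy + gz - gx) * y * z + (gz + gx - gy) * z * x)"
    unfolding cubic_def gx_def gy_def gz_def by algebra
  with assms show ?thesis by (simp add: gx_def gy_def gz_def)
qed

text \<open>
Half the second \<open>x\<close>-derivative at \<open>(1,1,1)\<close>, as a combination of squares. Cyclic symmetry gives the
other two diagonal derivatives, and these determine the whole Hessian.
\<close>

lemma extremal_cubic_hessian_xx:
  "3 * (q^2 * edge_weight p q r) + (edge_weight q r p - 2 * r * (q^2 * edge_weight p q r))
    + (q^2 * (p^2 * edge_weight r p q) - 2 * q * edge_weight p q r) =
   (a1 q r ^ 3 * a2 p q r * (1 - p)^2 + a1 r p ^ 3 * a2 q r p * q^2 + a1 p q ^ 3 * a2 r p q) / 2"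
proof -
  have "2 * (3 * (q^2 * edge_weight p q r) + (edge_weight q r p - 2 * r * (q^2 * edge_weight p q r))
    + (q^2 * (p^2 * edge_weight r p q) - 2 * q * edge_weight p q r)) =
   a1 q r ^ 3 * a2 p q r * (1 - p)^2 + a1 r p ^ 3 * a2 q r p * q^2 + a1 p q ^ 3 * a2 r p q"
    unfolding edge_weight_def a1_def a2_def by algebra
  then show ?thesis by simp
qed

text \<open>
The second derivative of \<^const>\<open>extremal_cubic\<close> at \<open>e = (1,1,1)\<close> as a quadratic form. The three linear
forms are the determinants of \<open>e\<close>, a boundary zero and \<open>(x,y,z)\<close>. Each of them vanishes at its own
boundary zero, so the polar form at two different boundary zeros isolates one coefficient; this is
how the coefficients were obtained.
\<close>

definition hessian_at_ones :: "real \<Rightarrow> real \<Rightarrow> real \<Rightarrow> real \<Rightarrow> real \<Rightarrow> real \<Rightarrow> real" where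
  "hessian_at_ones p q r x y z =
     a1 q r ^ 3 * a2 p q r * ((x - y) + p * (z - x))^2
   + a1 r p ^ 3 * a2 q r p * ((y - z) + q * (x - y))^2
   + a1 p q ^ 3 * a2 r p q * ((z - x) + r * (y - z))^2"

lemma extremal_cubic_expand_along_ones:
  "extremal_cubic p q r (s + x) (s + y) (s + z) =
     s / 2 * hessian_at_ones p q r x y z + extremal_cubic p q r x y z"
proof -
  define u v w where uvw: "u = edge_weight p q r" "v = edge_weight q r p" "w = edge_weight r p q"
  define A B C where ABC: "A = a1 q r ^ 3 * a2 p q r" "B = a1 r p ^ 3 * a2 q r p" "C = a1 p q ^ 3 * a2 r p q"
  have hx: "3 * (q^2 * u) + (v - 2 * r * (q^2 * u)) + (q^2 * (p^2 * w) - 2 * q * u)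
      = (A * (1 - p)^2 + B * q^2 + C) / 2"
    and hy: "3 * (r^2 * v) + (r^2 * (q^2 * u) - 2 * r * v) + (w - 2 * p * (r^2 * v))
      = (B * (1 - q)^2 + C * r^2 + A) / 2"
    and hz: "3 * (p^2 * w) + (p^2 * (r^2 * v) - 2 * p * w) + (u - 2 * q * (p^2 * w))
      = (C * (1 - r)^2 + A * p^2 + B) / 2"
    using extremal_cubic_hessian_xx[of q p r] extremal_cubic_hessian_xx[of r q p]
      extremal_cubic_hessian_xx[of p r q]
    unfolding uvw ABC by linarith+
  have "extremal_cubic p q r (s + x) (s + y) (s + z) =
      s * ((A * (1 - p)^2 + B * q^2 + C) / 2 * (x - y) * (x - z)
         + (B * (1 - q)^2 + C * r^2 + A) / 2 * (y - x) * (y - z)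
         + (C * (1 - r)^2 + A * p^2 + B) / 2 * (z - x) * (z - y)) + extremal_cubic p q r x y z"
    unfolding extremal_cubic_def tangent_cubic_def uvw[symmetric]
  proof (subst cubic_expand_along_ones)
    show "3 * (q\<^sup>2 * u) + 2 * (v - 2 * r * (q\<^sup>2 * u)) + (r\<^sup>2 * (q\<^sup>2 * u) - 2 * r * v) +
      (u - 2 * q * (p\<^sup>2 * w)) + 2 * (q\<^sup>2 * (p\<^sup>2 * w) - 2 * q * u) + c4 p q r = 0"
      using dx_extremal_cubic[of p q r] by (simp add: dx_at_ones_def uvw)
    show "3 * (r\<^sup>2 * v) + 2 * (w - 2 * p * (r\<^sup>2 * v)) + (p\<^sup>2 * (r\<^sup>2 * v) - 2 * p * w) +
      (v - 2 * r * (q\<^sup>2 * u)) + 2 * (r\<^sup>2 * (q\<^sup>2 * u) - 2 * r * v) + c4 p q r = 0"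
      using dx_extremal_cubic[of q r p] by (simp add: dx_at_ones_def uvw c4_cyclic[of p q r])
    show "3 * (p\<^sup>2 * w) + 2 * (u - 2 * q * (p\<^sup>2 * w)) + (q\<^sup>2 * (p\<^sup>2 * w) - 2 * q * u) +
      (w - 2 * p * (r\<^sup>2 * v)) + 2 * (p\<^sup>2 * (r\<^sup>2 * v) - 2 * p * w) + c4 p q r = 0"
      using dx_extremal_cubic[of r p q] by (simp add: dx_at_ones_def uvw c4_cyclic[of r p q])
  qed (simp only: hx hy hz)
  also have "(A * (1 - p)^2 + B * q^2 + C) / 2 * (x - y) * (x - z)
         + (B * (1 - q)^2 + C * r^2 + A) / 2 * (y - x) * (y - z)
         + (C * (1 - r)^2 + A * p^2 + B) / 2 * (z - x) * (z - y) = hessian_at_ones p q r x y z / 2"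
    unfolding hessian_at_ones_def ABC[symmetric] by (simp add: field_simps power2_eq_square)
  finally show ?thesis by simp
qed

text \<open>
The hypotheses on the parameters; they are invariant under cyclic shifts.
\<close>

locale admissible =
  fixes p q r :: real
  assumes nonneg: "p \<ge> 0" "q \<ge> 0" "r \<ge> 0"
    and a1_pos: "a1 p q > 0" "a1 q r > 0" "a1 r p > 0"
begin

lemma weights_pos:
  "edge_weight p q r > 0" "edge_weight q r p > 0" "edge_weight r p q > 0"
  using nonneg a1_pos by (auto intro!: edge_weight_pos)

lemma a2s_pos: "a2 p q r > 0" "a2 q r p > 0" "a2 r p q > 0"
  using nonneg a1_pos by (auto intro!: a2_pos)

lemma hessian_at_ones_nonneg: "hessian_at_ones p q r x y z \<ge> 0"
  using a2s_pos a1_pos by (simp add: hessian_at_ones_def)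

lemma hessian_at_ones_eq_0D:
  assumes "hessian_at_ones p q r x y z = 0"
  shows "x = y" "y = z"
proof -
  have pos: "a1 q r ^ 3 * a2 p q r > 0" "a1 r p ^ 3 * a2 q r p > 0" "a1 p q ^ 3 * a2 r p q > 0"
    using a2s_pos a1_pos by auto
  have sq: "a = 0 \<and> b = 0" if "A * a^2 + B * b^2 + C * c^2 = 0" "A > 0" "B > 0" "C > 0"
    for A B C a b c :: real
  proof -
    have "A * a^2 \<ge> 0" "B * b^2 \<ge> 0" "C * c^2 \<ge> 0" using that by auto
    with that have "A * a^2 = 0" "B * b^2 = 0" by linarith+
    with that show ?thesis by simp
  qed
  have *: "(x - y) + p * (z - x) = 0" "(y - z) + q * (x - y) = 0"
    using sq[OF assms[unfolded hessian_at_ones_def] pos] by auto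
  have "a1 p q * (x - y) = 0"
    using * unfolding a1_def by algebra
  with a1_pos show "x = y" by simp
  with * show "y = z" by simp
qed

lemma extremal_cubic_face:
  "extremal_cubic p q r 0 y z = (y - p * z)^2 * (r^2 * edge_weight q r p * y + edge_weight r p q * z)"
  by (simp add: extremal_cubic_def tangent_cubic_edge)

lemma extremal_cubic_face_nonneg: "y \<ge> 0 \<Longrightarrow> z \<ge> 0 \<Longrightarrow> extremal_cubic p q r 0 y z \<ge> 0"
  unfolding extremal_cubic_face using nonneg weights_pos by simp

end

lemma admissible_cyclic: "admissible p q r \<Longrightarrow> admissible q r p"
  by (simp add: admissible_def)

text \<open>
Subtracting the smallest coordinate moves the point along the direction of \<open>(1,1,1)\<close> to a face.
\<close>

lemma (in admissible) extremal_cubic_nonneg: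
  assumes "x \<ge> 0" "y \<ge> 0" "z \<ge> 0"
  shows "extremal_cubic p q r x y z \<ge> 0"
proof -
  define s where "s = min x (min y z)"
  have s: "s \<ge> 0" "x - s \<ge> 0" "y - s \<ge> 0" "z - s \<ge> 0" "x - s = 0 \<or> y - s = 0 \<or> z - s = 0"
    using assms by (auto simp: s_def min_def)
  interpret q: admissible q r p by (rule admissible_cyclic) (rule admissible_axioms)
  interpret r: admissible r p q by (rule admissible_cyclic) (rule q.admissible_axioms)
  have "extremal_cubic p q r (x - s) (y - s) (z - s) \<ge> 0"
    using s extremal_cubic_face_nonneg[of "y - s" "z - s"]
      q.extremal_cubic_face_nonneg[of "z - s" "x - s"]
      r.extremal_cubic_face_nonneg[of "x - s" "y - s"]
      extremal_cubic_cyclic[of p q r] extremal_cubic_cyclic[of q r p] by auto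
  then show ?thesis
    using extremal_cubic_expand_along_ones[of p q r s "x - s" "y - s" "z - s"]
      hessian_at_ones_nonneg s by simp
qed

lemma H33_eq: "f \<in> H33 \<longleftrightarrow> homogeneous3 3 f"
  by (simp add: H33_def homogeneous3_def)

lemma coeff3_f_pqr:
  "coeff3 (f_pqr p q r) i j k =
     (if i = 3 \<and> j = 0 \<and> k = 0 then c1 p q r else 0)
   + (if i = 0 \<and> j = 3 \<and> k = 0 then c1 q r p else 0)
   + (if i = 0 \<and> j = 0 \<and> k = 3 then c1 r p q else 0)
   + (if i = 2 \<and> j = 1 \<and> k = 0 then c2 p q r else 0)
   + (if i = 1 \<and> j = 2 \<and> k = 0 then c3 p q r else 0)
   + (if i = 0 \<and> j = 2 \<and> k = 1 then c2 q r p else 0)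
   + (if i = 0 \<and> j = 1 \<and> k = 2 then c3 q r p else 0)
   + (if i = 1 \<and> j = 0 \<and> k = 2 then c2 r p q else 0)
   + (if i = 2 \<and> j = 0 \<and> k = 1 then c3 r p q else 0)
   + (if i = 1 \<and> j = 1 \<and> k = 1 then c4 p q r else 0)"
proof -
  have "f_pqr p q r =
     const3 (c1 p q r) * X3^3 * Y3^0 * Z3^0 + const3 (c1 q r p) * X3^0 * Y3^3 * Z3^0
   + const3 (c1 r p q) * X3^0 * Y3^0 * Z3^3
   + const3 (c2 p q r) * X3^2 * Y3^1 * Z3^0 + const3 (c3 p q r) * X3^1 * Y3^2 * Z3^0
   + const3 (c2 q r p) * X3^0 * Y3^2 * Z3^1 + const3 (c3 q r p) * X3^0 * Y3^1 * Z3^2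
   + const3 (c2 r p q) * X3^1 * Y3^0 * Z3^2 + const3 (c3 r p q) * X3^2 * Y3^0 * Z3^1
   + const3 (c4 p q r) * X3^1 * Y3^1 * Z3^1"
    by (simp add: f_pqr_def mult_ac)
  then show ?thesis
    by (simp only: coeff3_add coeff3_monomial)
qed

lemma (in admissible) f_pqr_in_P33_plus: "f_pqr p q r \<in> P33_plus"
proof -
  have "f_pqr p q r \<in> H33"
    by (auto simp: H33_def coeff3_f_pqr split: if_splits)
  then show ?thesis
    using extremal_cubic_nonneg by (simp add: P33_plus_def eval3_f_pqr)
qed

lemma (in admissible) f_pqr_nonzero: "f_pqr p q r \<noteq> 0"
proof
  assume "f_pqr p q r = 0"
  then have "extremal_cubic p q r 0 (p + 1) 1 = 0"
    using eval3_f_pqr[of p q r 0 "p + 1" 1] by (simp add: eval3_def)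
  moreover have "extremal_cubic p q r 0 (p + 1) 1 > 0"
    unfolding extremal_cubic_face using weights_pos nonneg by (simp add: add_nonneg_pos)
  ultimately show False by simp
qed

section \<open>Irreducibility\<close>

text \<open>
A linear factor through \<open>(1,1,1)\<close> contradicts the definiteness of the Hessian transversally to
\<open>(1,1,1)\<close>; otherwise the quadratic factor is proportional to the Hessian, and the linear factor cannot
produce the double root on the face \<open>x = 0\<close>.
\<close>

lemma (in admissible) extremal_cubic_not_linear_times_quadratic:
  assumes fac: "\<And>x y z. extremal_cubic p q r x y z = (a * x + b * y + c * z) *
    (h1 * x^2 + h2 * y^2 + h3 * z^2 + h4 * x * y + h5 * y * z + h6 * z * x)"
  shows False
proof -
  define L where "L x y z = a * x + b * y + c * z" for x y z
  define H where "H x y z = h1 * x^2 + h2 * y^2 + h3 * z^2 + h4 * x * y + h5 * y * z + h6 * z * x" for x y z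
  define S where "S x y z = hessian_at_ones p q r x y z / 2" for x y z
  have fac': "extremal_cubic p q r x y z = L x y z * H x y z" for x y z
    by (simp add: fac L_def H_def)
  have line: "L (1 + t * x) (1 + t * y) (1 + t * z) * H (1 + t * x) (1 + t * y) (1 + t * z)
     = t^2 * S x y z + t^3 * (L x y z * H x y z)" for t x y z
  proof -
    have "hessian_at_ones p q r (t * x) (t * y) (t * z) = t^2 * hessian_at_ones p q r x y z"
      unfolding hessian_at_ones_def by algebra
    moreover have "L (t * x) (t * y) (t * z) * H (t * x) (t * y) (t * z) = t^3 * (L x y z * H x y z)"
      unfolding L_def H_def by algebra
    ultimately show ?thesis
      using extremal_cubic_expand_along_ones[of p q r 1 "t * x" "t * y" "t * z"]
      by (simp add: fac' S_def)
  qed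
  have face: "L 0 t 1 * H 0 t 1 = (t - p)^2 * (r^2 * edge_weight q r p * t + edge_weight r p q)" for t
    using extremal_cubic_face[of t 1] by (simp add: fac')
  have nz: "L 0 (p + 1) 1 \<noteq> 0"
  proof -
    have "r^2 * edge_weight q r p * (p + 1) + edge_weight r p q > 0"
      using weights_pos nonneg by (intro add_nonneg_pos) auto
    then show ?thesis using face[of "p + 1"] by auto
  qed
  show False
  proof (cases "L 1 1 1 = 0")
    case True
    \<comment> \<open>the direction \<open>(b, -a, 0)\<close> lies in the plane \<open>L = 0\<close>\<close>
    then have L0: "L (1 + t * b) (1 + t * (- a)) (1 + t * 0) = 0" for t
      unfolding L_def by algebra
    have "S b (- a) 0 = 0"
      using line[of 1 b "- a" 0] line[of "-1" b "- a" 0] unfolding L0 by (simp, linarith?)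
    then have "b = 0" "a = 0" using hessian_at_ones_eq_0D[of b "- a" 0] by (auto simp: S_def)
    with True nz show False by (simp add: L_def)
  next
    case False
    have H1: "H 1 1 1 = 0" using line[of 0 0 0 0] False by simp
    \<comment> \<open>as \<open>L\<close> is nonzero at the singular point, \<open>H\<close> is singular there and carries the Hessian\<close>
    have LH: "L 1 1 1 * H x y z = S x y z" for x y z
    proof -
      \<comment> \<open>the derivative of \<open>H\<close> at \<open>(1,1,1)\<close> in the direction \<open>(x,y,z)\<close>\<close>
      define H' where "H' = H (1 + x) (1 + y) (1 + z) - H 1 1 1 - H x y z"
      have "H (1 + t * x) (1 + t * y) (1 + t * z) = H 1 1 1 + t * H' + t^2 * H x y z" for t
        by (simp add: H'_def H_def algebra_simps power2_eq_square)
      then have H: "H (1 + t * x) (1 + t * y) (1 + t * z) = t * H' + t^2 * H x y z" for t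
        by (simp add: H1)
      have L: "L (1 + t * x) (1 + t * y) (1 + t * z) = L 1 1 1 + t * L x y z" for t
        unfolding L_def by algebra
      have 1: "(L 1 1 1 + L x y z) * (H' + H x y z) = S x y z + L x y z * H x y z"
        using line[of 1 x y z] unfolding H L by simp
      have 2: "(L 1 1 1 - L x y z) * (H x y z - H') = S x y z - L x y z * H x y z"
        using line[of "-1" x y z] unfolding H L by simp
      from 1 2 have "L 1 1 1 * H' = 0" by algebra
      with False have "H' = 0" by simp
      with 1 show ?thesis by (simp add: algebra_simps)
    qed
    have "H 0 p 1 \<noteq> 0"
      using LH[of 0 p 1] hessian_at_ones_eq_0D[of 0 p 1] by (auto simp: S_def)
    moreover have "L 0 p 1 * H 0 p 1 = 0" using face[of p] by simp
    ultimately have L0: "L 0 p 1 = 0" by simp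
    (* Dividing by t - p loses the point t = p. Both sides are quadratic in t, so the values at four
       other points, here p - 2, p - 1, p + 1 and p + 2, determine the value at p. *)
    have "b * H 0 t 1 = (t - p) * (r^2 * edge_weight q r p * t + edge_weight r p q)" if "t \<noteq> p" for t
    proof -
      have "L 0 t 1 = (t - p) * b" using L0 unfolding L_def by algebra
      with face[of t] that show ?thesis by (simp add: power2_eq_square)
    qed
    from this[of "p + 1"] this[of "p - 1"] this[of "p + 2"] this[of "p - 2"]
    have "6 * (b * H 0 p 1) = 0"
      unfolding H_def by simp algebra
    with \<open>H 0 p 1 \<noteq> 0\<close> have "b = 0" by simp
    with L0 nz show False by (simp add: L_def)
  qed
qed

definition vanishes_at_points :: "real \<Rightarrow> real \<Rightarrow> real \<Rightarrow> poly3 \<Rightarrow> bool" where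
  "vanishes_at_points p q r f \<longleftrightarrow>
     eval3 f 1 1 1 = 0 \<and> eval3 f 0 p 1 = 0 \<and> eval3 f 1 0 q = 0 \<and> eval3 f r 1 0 = 0"

lemma f_pqr_vanishes: "vanishes_at_points p q r (f_pqr p q r)"
proof -
  have "eval3 (f_pqr p q r) 1 1 1 = 0"
    by (simp add: f_pqr_def c4_def)
  moreover have "extremal_cubic p q r 0 p 1 = 0"
    by (simp add: extremal_cubic_def tangent_cubic_edge)
  moreover have "extremal_cubic p q r 1 0 q = 0"
    unfolding extremal_cubic_cyclic[of p q r] by (simp add: extremal_cubic_def tangent_cubic_edge)
  moreover have "extremal_cubic p q r r 1 0 = 0"
    unfolding extremal_cubic_cyclic[of p q r] extremal_cubic_cyclic[of q r p]
    by (simp add: extremal_cubic_def tangent_cubic_edge)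
  ultimately show ?thesis
    by (simp add: vanishes_at_points_def eval3_f_pqr)
qed

lemma (in admissible) f_pqr_irreducible: "irreducible (f_pqr p q r)"
proof (rule irreducibleI)
  show "f_pqr p q r \<noteq> 0" by (rule f_pqr_nonzero)
  show "\<not> f_pqr p q r dvd 1"
  proof
    assume "f_pqr p q r dvd 1"
    then obtain g where "1 = f_pqr p q r * g" by (rule dvdE)
    from arg_cong[OF this, of "\<lambda>f. eval3 f 1 1 1"]
    have "eval3 1 1 1 1 = eval3 (f_pqr p q r) 1 1 1 * eval3 g 1 1 1" by simp
    then show False
      using f_pqr_vanishes[of p q r] by (simp add: vanishes_at_points_def eval3_def)
  qed
  fix g h assume gh: "f_pqr p q r = g * h"
  have nz: "g * h \<noteq> 0" using f_pqr_nonzero gh by simp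
  have no: False if "homogeneous3 1 g" "homogeneous3 2 h" "f_pqr p q r = g * h" for g h
    using that eval3_f_pqr[of p q r, symmetric]
    by (intro extremal_cubic_not_linear_times_quadratic)
      (simp add: eval3_linear_form eval3_quadratic_form)
  have "homogeneous3 3 (g * h)"
    using f_pqr_in_P33_plus gh by (simp add: P33_plus_def H33_eq)
  then obtain a b where hom: "homogeneous3 a g" "homogeneous3 b h" and ab: "a + b = 3"
    using nz by (rule homogeneous3_factor)
  from ab consider "a = 0" | "b = 0" | "a = 1" "b = 2" | "a = 2" "b = 1" by linarith
  then show "g dvd 1 \<or> h dvd 1"
  proof cases
    case 1
    then show ?thesis using hom nz is_unit_if_homogeneous3_0 by auto
  next
    case 2
    then show ?thesis using hom nz is_unit_if_homogeneous3_0 by auto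
  next
    case 3
    then show ?thesis using hom no gh by blast
  next
    case 4
    then show ?thesis using hom no[of h g] gh by (simp add: mult.commute)
  qed
qed

section \<open>Rigidity and extremality\<close>

text \<open>
At an end point of the half-line the derivative at a zero is still nonnegative, which is all that
is left of the double root when \<open>p = 0\<close>.
\<close>

lemma cubic_nonneg_root:
  fixes a b c d p :: real
  assumes nonneg: "\<And>t. t \<ge> 0 \<Longrightarrow> a * t^3 + b * t^2 + c * t + d \<ge> 0"
    and root: "a * p^3 + b * p^2 + c * p + d = 0" and p: "p \<ge> 0"
  shows "3 * p^2 * a + 2 * p * b + c \<ge> 0" "p > 0 \<Longrightarrow> 3 * p^2 * a + 2 * p * b + c = 0"
proof -
  define P where "P t = a * t^3 + b * t^2 + c * t + d" for t
  have D: "(P has_real_derivative 3 * p^2 * a + 2 * p * b + c) (at p)"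
    unfolding P_def by (auto intro!: derivative_eq_intros)
  show ge: "3 * p^2 * a + 2 * p * b + c \<ge> 0"
  proof (rule ccontr)
    assume "\<not> ?thesis"
    with D obtain e where "e > 0" "\<And>h. 0 < h \<Longrightarrow> h < e \<Longrightarrow> P (p + h) < P p"
      using DERIV_neg_dec_right[of P] by force
    from this(2)[of "e / 2"] this(1) nonneg[of "p + e / 2"] root p show False
      by (simp add: P_def)
  qed
  assume "p > 0"
  then have "3 * p^2 * a + 2 * p * b + c = 0"
    using DERIV_local_min[OF D, of p] nonneg root by (simp add: P_def abs_real_def)
  then show "3 * p^2 * a + 2 * p * b + c = 0" .
qed

lemma cubic_double_root:
  fixes a b c d p :: real
  assumes "a * p^3 + b * p^2 + c * p + d = 0" "3 * p^2 * a + 2 * p * b + c = 0"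
  shows "c = p^2 * a - 2 * p * (b + 2 * p * a)" "d = p^2 * (b + 2 * p * a)"
  using assms by algebra+

lemma eval3_H33:
  assumes "f \<in> H33"
  shows "eval3 f x y z = cubic (coeff3 f 3 0 0) (coeff3 f 0 3 0) (coeff3 f 0 0 3)
     (coeff3 f 2 1 0) (coeff3 f 1 2 0) (coeff3 f 0 2 1) (coeff3 f 0 1 2)
     (coeff3 f 1 0 2) (coeff3 f 2 0 1) (coeff3 f 1 1 1) x y z"
proof -
  have "homogeneous3 3 f" using assms by (simp add: H33_eq)
  then show ?thesis
    by (simp add: eval3_homogeneous[OF \<open>homogeneous3 3 f\<close>] homogeneous3_coeff cubic_def
        numeral_eq_Suc)
qed

text \<open>
The derivatives along the faces at the boundary zeros: of \<open>f(0,t,1)\<close> at \<open>p\<close>, of \<open>f(1,0,t)\<close> at \<open>q\<close> and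
of \<open>f(t,1,0)\<close> at \<open>r\<close>.
\<close>

definition slope_x :: "poly3 \<Rightarrow> real \<Rightarrow> real" where
  "slope_x f p = 3 * p^2 * coeff3 f 0 3 0 + 2 * p * coeff3 f 0 2 1 + coeff3 f 0 1 2"
definition slope_y :: "poly3 \<Rightarrow> real \<Rightarrow> real" where
  "slope_y f q = 3 * q^2 * coeff3 f 0 0 3 + 2 * q * coeff3 f 1 0 2 + coeff3 f 2 0 1"
definition slope_z :: "poly3 \<Rightarrow> real \<Rightarrow> real" where
  "slope_z f r = 3 * r^2 * coeff3 f 3 0 0 + 2 * r * coeff3 f 2 1 0 + coeff3 f 1 2 0"

lemma slope_add:
  "slope_x (f + g) p = slope_x f p + slope_x g p"
  "slope_y (f + g) q = slope_y f q + slope_y g q"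
  "slope_z (f + g) r = slope_z f r + slope_z g r"
  by (simp_all add: slope_x_def slope_y_def slope_z_def coeff3_add distrib_left)

lemma f_pqr_slopes:
  "slope_x (f_pqr p q r) p = 0" "slope_y (f_pqr p q r) q = 0" "slope_z (f_pqr p q r) r = 0"
  unfolding slope_x_def slope_y_def slope_z_def coeff3_f_pqr c_edge_weight
  by (simp_all add: algebra_simps power2_eq_square)

lemma P33_plus_slopes:
  assumes "f \<in> P33_plus" "vanishes_at_points p q r f" "p \<ge> 0" "q \<ge> 0" "r \<ge> 0"
  shows "slope_x f p \<ge> 0" "slope_y f q \<ge> 0" "slope_z f r \<ge> 0"
    and "p > 0 \<Longrightarrow> slope_x f p = 0" "q > 0 \<Longrightarrow> slope_y f q = 0" "r > 0 \<Longrightarrow> slope_z f r = 0"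
proof -
  have f: "f \<in> H33" and nonneg: "x \<ge> 0 \<Longrightarrow> y \<ge> 0 \<Longrightarrow> z \<ge> 0 \<Longrightarrow> eval3 f x y z \<ge> 0" for x y z
    using assms(1) by (auto simp: P33_plus_def)
  note ev = eval3_H33[OF f] cubic_def
  have x: "coeff3 f 0 3 0 * t^3 + coeff3 f 0 2 1 * t^2 + coeff3 f 0 1 2 * t + coeff3 f 0 0 3 =
      eval3 f 0 t 1" for t by (simp add: ev)
  have y: "coeff3 f 0 0 3 * t^3 + coeff3 f 1 0 2 * t^2 + coeff3 f 2 0 1 * t + coeff3 f 3 0 0 =
      eval3 f 1 0 t" for t by (simp add: ev)
  have z: "coeff3 f 3 0 0 * t^3 + coeff3 f 2 1 0 * t^2 + coeff3 f 1 2 0 * t + coeff3 f 0 3 0 =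
      eval3 f t 1 0" for t by (simp add: ev)
  note roots = assms(2)[unfolded vanishes_at_points_def]
  note slope_x = cubic_nonneg_root[of "coeff3 f 0 3 0" "coeff3 f 0 2 1" "coeff3 f 0 1 2"
      "coeff3 f 0 0 3" p, unfolded x]
  note slope_y = cubic_nonneg_root[of "coeff3 f 0 0 3" "coeff3 f 1 0 2" "coeff3 f 2 0 1"
      "coeff3 f 3 0 0" q, unfolded y]
  note slope_z = cubic_nonneg_root[of "coeff3 f 3 0 0" "coeff3 f 2 1 0" "coeff3 f 1 2 0"
      "coeff3 f 0 3 0" r, unfolded z]
  show "slope_x f p \<ge> 0" "p > 0 \<Longrightarrow> slope_x f p = 0"
    using slope_x roots nonneg assms(3) by (simp_all add: slope_x_def)
  show "slope_y f q \<ge> 0" "q > 0 \<Longrightarrow> slope_y f q = 0"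
    using slope_y roots nonneg assms(4) by (simp_all add: slope_y_def)
  show "slope_z f r \<ge> 0" "r > 0 \<Longrightarrow> slope_z f r = 0"
    using slope_z roots nonneg assms(5) by (simp_all add: slope_z_def)
qed

lemma tangent_cubic_scale:
  "tangent_cubic p q r (l * u) (l * v) (l * w) (l * m) x y z = l * tangent_cubic p q r u v w m x y z"
  unfolding tangent_cubic_def cubic_def by algebra

lemma dx_at_ones_scale:
  "dx_at_ones p q r (l * u) (l * v) (l * w) (l * m) = l * dx_at_ones p q r u v w m"
  unfolding dx_at_ones_def by algebra

lemma dx_at_ones_inject:
  "dx_at_ones p q r u v w m = dx_at_ones p q r u v w m' \<longleftrightarrow> m = m'"
  by (simp add: dx_at_ones_def)

text \<open>
Rigidity: at a parameter equal to \<open>0\<close> the zero at a vertex does not make the slope vanish, so the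
slopes enter as hypotheses; this is the form in which extremality can use it for all parameters.
\<close>

lemma (in admissible) proportional_to_f_pqr:
  assumes "f \<in> P33_plus" "vanishes_at_points p q r f"
    and slopes: "slope_x f p = 0" "slope_y f q = 0" "slope_z f r = 0"
  shows "\<exists>\<alpha>. f = const3 \<alpha> * f_pqr p q r"
proof -
  have f: "f \<in> H33" and nonneg: "x \<ge> 0 \<Longrightarrow> y \<ge> 0 \<Longrightarrow> z \<ge> 0 \<Longrightarrow> eval3 f x y z \<ge> 0" for x y z
    using assms(1) by (auto simp: P33_plus_def)
  note roots = assms(2)[unfolded vanishes_at_points_def]
  define X Y Z where XYZ: "X = coeff3 f 3 0 0" "Y = coeff3 f 0 3 0" "Z = coeff3 f 0 0 3"
  define a b c where abc: "a = coeff3 f 2 1 0" "b = coeff3 f 1 2 0" "c = coeff3 f 0 2 1"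
  define d e k m where dekm:
    "d = coeff3 f 0 1 2" "e = coeff3 f 1 0 2" "k = coeff3 f 2 0 1" "m = coeff3 f 1 1 1"
  note co = XYZ abc dekm
  have ev: "eval3 f x y z = cubic X Y Z a b c d e k m x y z" for x y z
    unfolding co by (rule eval3_H33[OF f])
  \<comment> \<open>coefficients of the linear cofactors of the double roots, read off from \<open>cubic_double_root\<close>\<close>
  define u v w where uvw: "u = e + 2 * q * Z" "v = a + 2 * r * X" "w = c + 2 * p * Y"
  have sl: "3 * p^2 * Y + 2 * p * c + d = 0" "3 * q^2 * Z + 2 * q * e + k = 0"
     "3 * r^2 * X + 2 * r * a + b = 0"
    using slopes by (simp_all add: slope_x_def slope_y_def slope_z_def co)
  have r1: "Y * p^3 + c * p^2 + d * p + Z = 0"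
    and r2: "Z * q^3 + e * q^2 + k * q + X = 0"
    and r3: "X * r^3 + a * r^2 + b * r + Y = 0"
    using roots by (simp_all add: ev cubic_def)
  have dk: "Z = p^2 * w" "X = q^2 * u" "Y = r^2 * v"
    "d = p^2 * Y - 2 * p * w" "k = q^2 * Z - 2 * q * u" "b = r^2 * X - 2 * r * v"
    unfolding uvw
    by (fact cubic_double_root[OF r1 sl(1)] cubic_double_root[OF r2 sl(2)]
        cubic_double_root[OF r3 sl(3)])+
  have ceo: "c = w - 2 * p * Y" "e = u - 2 * q * Z" "a = v - 2 * r * X"
    by (simp_all add: uvw)
  have tan: "eval3 f x y z = tangent_cubic p q r u v w m x y z" for x y z
    unfolding ev tangent_cubic_def by (simp only: dk[symmetric] ceo[symmetric])
  have tx: "X * t^3 + (a + k) * t^2 + (b + e + m) * t + (Y + Z + c + d) = eval3 f t 1 1"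
    and ty: "Y * t^3 + (b + c) * t^2 + (a + d + m) * t + (X + Z + e + k) = eval3 f 1 t 1"
    and tz: "Z * t^3 + (d + e) * t^2 + (c + k + m) * t + (X + Y + a + b) = eval3 f 1 1 t" for t
    by (simp_all add: ev cubic_def algebra_simps)
  have gx: "3 * X + 2 * (a + k) + (b + e + m) = 0"
    using cubic_nonneg_root(2)[of X "a + k" "b + e + m" "Y + Z + c + d" 1, unfolded tx]
      roots nonneg by simp
  have gy: "3 * Y + 2 * (b + c) + (a + d + m) = 0"
    using cubic_nonneg_root(2)[of Y "b + c" "a + d + m" "X + Z + e + k" 1, unfolded ty]
      roots nonneg by simp
  have gz: "3 * Z + 2 * (d + e) + (c + k + m) = 0"
    using cubic_nonneg_root(2)[of Z "d + e" "c + k + m" "X + Y + a + b" 1, unfolded tz]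
      roots nonneg by simp
  have D: "dx_at_ones p q r u v w m = 0" "dx_at_ones q r p v w u m = 0"
    "dx_at_ones r p q w u v m = 0"
    unfolding dx_at_ones_def dk[symmetric] ceo[symmetric]
    using gx gy gz by (simp_all add: algebra_simps)
  define \<alpha> where "\<alpha> = u / edge_weight p q r"
  have "u = \<alpha> * edge_weight p q r"
    using weights_pos by (simp add: \<alpha>_def)
  moreover have "v = \<alpha> * edge_weight q r p"
    using proportional_if_singular[OF D] weights_pos by (simp add: \<alpha>_def field_simps)
  moreover have "w = \<alpha> * edge_weight r p q"
    using proportional_if_singular[OF D(3,1,2)] weights_pos by (simp add: \<alpha>_def field_simps)
  moreover from calculation have "m = \<alpha> * c4 p q r"
    using D(1) dx_at_ones_scale[of p q r \<alpha> "edge_weight p q r" "edge_weight q r p"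
        "edge_weight r p q" "c4 p q r"] dx_extremal_cubic[of p q r]
    by (metis dx_at_ones_inject mult_zero_right)
  ultimately have "eval3 f x y z = eval3 (const3 \<alpha> * f_pqr p q r) x y z" for x y z
    by (simp only: tan tangent_cubic_scale) (simp add: eval3_f_pqr extremal_cubic_def)
  then have "f = const3 \<alpha> * f_pqr p q r" by (rule eval3_inject)
  then show ?thesis ..
qed

text \<open>
The slopes of the summands are nonnegative and add up to the slopes of \<^const>\<open>f_pqr\<close>, which are
\<open>0\<close>.
\<close>

lemma (in admissible) f_pqr_extremal: "f_pqr p q r \<in> extremals P33_plus"
proof -
  have "\<exists>a. g = const3 a * f_pqr p q r"
    if g: "g \<in> P33_plus" and h: "h \<in> P33_plus" and sum: "f_pqr p q r = g + h" for g h
  proof -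
    have ev: "eval3 g x y z = 0 \<and> eval3 h x y z = 0"
      if "x \<ge> 0" "y \<ge> 0" "z \<ge> 0" "eval3 (f_pqr p q r) x y z = 0" for x y z
      using g h that unfolding sum P33_plus_def by (simp add: add_nonneg_eq_0_iff)
    have van: "vanishes_at_points p q r g" "vanishes_at_points p q r h"
      using f_pqr_vanishes[of p q r] nonneg ev unfolding vanishes_at_points_def by auto
    have "slope_x g p = 0" "slope_y g q = 0" "slope_z g r = 0"
      using P33_plus_slopes(1-3)[OF g van(1) nonneg] P33_plus_slopes(1-3)[OF h van(2) nonneg]
        f_pqr_slopes[of p q r]
      unfolding sum slope_add by auto
    then show ?thesis
      by (rule proportional_to_f_pqr[OF g van(1)])
  qed
  note split = this
  show ?thesis
    unfolding extremals_def mem_Collect_eq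
  proof (intro conjI ballI impI)
    fix g h assume *: "g \<in> P33_plus" "h \<in> P33_plus" "f_pqr p q r = g + h"
    show "\<exists>a. g = const3 a * f_pqr p q r" by (rule split[OF *])
    show "\<exists>b. h = const3 b * f_pqr p q r"
      by (rule split[OF *(2,1)]) (simp add: * add.commute)
  qed (rule f_pqr_in_P33_plus f_pqr_nonzero)+
qed

theorem theorem1p1:
  fixes p q r :: real
  assumes "p \<ge> 0" and "q \<ge> 0" and "r \<ge> 0"
    and "p * q - p + 1 > 0" and "q * r - q + 1 > 0" and "r * p - r + 1 > 0"
  shows "(irreducible (f_pqr p q r) \<and> f_pqr p q r \<in> extremals P33_plus \<and>
          eval3 (f_pqr p q r) 1 1 1 = 0 \<and> eval3 (f_pqr p q r) 0 p 1 = 0 \<and>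
          eval3 (f_pqr p q r) 1 0 q = 0 \<and> eval3 (f_pqr p q r) r 1 0 = 0) \<and>
         (p > 0 \<and> q > 0 \<and> r > 0 \<longrightarrow>
          (\<forall>f\<in>P33_plus.
             eval3 f 1 1 1 = 0 \<and> eval3 f 0 p 1 = 0 \<and> eval3 f 1 0 q = 0 \<and> eval3 f r 1 0 = 0 \<longrightarrow>
             (\<exists>\<alpha>. f = const3 \<alpha> * f_pqr p q r)))"
proof -
  interpret admissible p q r
    using assms by unfold_locales (simp_all add: a1_def)
  have "\<exists>\<alpha>. f = const3 \<alpha> * f_pqr p q r"
    if "p > 0" "q > 0" "r > 0" "f \<in> P33_plus" "vanishes_at_points p q r f" for f
    using that P33_plus_slopes(4-6)[of f p q r] by (intro proportional_to_f_pqr) simp_all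
  then show ?thesis
    using f_pqr_irreducible f_pqr_extremal f_pqr_vanishes[of p q r]
    unfolding vanishes_at_points_def by blast
qed

end
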